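(* For every $n\ge1$ and every $\pi\in\mathrm{PC}(n)$ let $a(\pi)\in\mathbb{C}$ be an arbitrary complex number, and let $b(\pi)$ (for $\pi\in\mathrm{PC}^+(n)$) and $c(\pi)$ (for $\pi\in\mathrm{CO}(n)$) be the associated weights described in the context. Let $$B(x)=\sum_{n=1}^\infty b_nx^n,\quad b_n=\sum_{\pi\in\mathrm{PC}^+(n)}b(\pi),\qquad C(x)=\sum_{n=1}^\infty c_nx^n,\quad c_n=\sum_{\pi\in\mathrm{CO}(n)}c(\pi).$$ Then, as formal power series, $$C(x)=B\left(\frac{x}{1-x}\right).$$
   Context: $[n]=\{1,\ldots,n\}$ and $\mathcal{P}(n)$ is the set of all set partitions of $[n]$. For $\pi\in\mathcal{P}(n)$, write $i\overset{\pi}{\sim}j$ if $i,j$ lie in the same block of $\pi$. A subset $S\subseteq[n]$ splits $\pi$ if $S$ is a union of some of the blocks of $\pi$. Consider, for $\pi\in\mathcal{P}(n)$, $n\ge1$, the conditions: (a) no proper subinterval $\{p+1,p+2,\ldots,p+q\}$ of $[n]$ (with $0\le p<p+q\le n$ and $q<n$) splits $\pi$; (b) $k\not\overset{\pi}{\sim}k+1$ for all $k\in[n-1]$; (c) $1\not\overset{\pi}{\sim}n$. $\mathrm{PC}(n)$ is the set of $\pi\in\mathcal{P}(n)$ satisfying (a), (b), (c); $\mathrm{PC}^+(n)$ is the set of those satisfying (a) and (b); $\mathrm{CO}(n)$ (connected partitions) is the set of those satisfying (a). $0_1$ denotes the unique partition of $[1]$. One has $\mathrm{PC}^+(1)=\{0_1\}$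 and, for $n\ge2$, $\mathrm{PC}^+(n)$ is the disjoint union of $\mathrm{PC}(n)$ and $\{\tilde\sigma\mid\sigma\in\mathrm{PC}(n-1)\}$, where $\tilde\sigma$ is obtained from $\sigma$ by adjoining $n$ to the block of $\sigma$ that contains $1$. Weights $b$: $b(0_1)=1$; for $n\ge2$, $b(\pi)=a(\pi)$ if $\pi\in\mathrm{PC}(n)$ and $b(\tilde\sigma)=a(\sigma)$ for $\sigma\in\mathrm{PC}(n-1)$. For $1\le\ell\le n$, $\sigma\in\mathrm{PC}^+(\ell)$ and integers $k_1,\ldots,k_\ell\ge1$ with $k_1+\cdots+k_\ell=n$, let $I_j=\{k_1+\cdots+k_{j-1}+1,\ldots,k_1+\cdots+k_{j-1}+k_j\}$ and let $\Phi_n(\sigma,k_1,\ldots,k_\ell)=\{\bigcup_{j\in S}I_j\mid S\in\sigma\}$. The map $\Phi_n$ is a bijection from the set of all such tuples $(\sigma,k_1,\ldots,k_\ell)$ (over all $1\le\ell\le n$) onto $\mathrm{CO}(n)$. Weights $c$: $c(\pi)=b(\sigma)$ for $\pi\in\mathrm{CO}(n)$, where $\pi=\Phi_n(\sigma,k_1,\ldots,k_\ell)$. *)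

theory Defs
  imports
    "HOL-Library.Disjoint_Sets"
    "HOL-Computational_Algebra.Formal_Power_Series"
begin

text \<open>
  A partition of \<open>[n]\<close> is a set \<open>\<pi>\<close> of blocks with \<open>partition_on {1..n} \<pi>\<close>.  Since \<open>\<pi>\<close> determines
  \<open>n\<close>, a weight on the partitions of all the sets \<open>[n]\<close> at once is a single function on
  \<open>nat set set\<close>; weights whose definition depends on \<open>n\<close> take it as an extra argument.
\<close>

definition same_block :: "nat set set \<Rightarrow> nat \<Rightarrow> nat \<Rightarrow> bool" where
  "same_block \<pi> i j \<longleftrightarrow> (\<exists>S\<in>\<pi>. i \<in> S \<and> j \<in> S)"

definition splits :: "nat set \<Rightarrow> nat set set \<Rightarrow> bool" where
  "splits S \<pi> \<longleftrightarrow> (\<exists>\<rho>. \<rho> \<subseteq> \<pi> \<and> S = \<Union>\<rho>)"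

definition CO :: "nat \<Rightarrow> nat set set set" where
  "CO n = {\<pi>. partition_on {1..n} \<pi> \<and>
     (\<forall>p q. p < p + q \<and> p + q \<le> n \<and> q < n \<longrightarrow> \<not> splits {p + 1..p + q} \<pi>)}"

definition PC_plus :: "nat \<Rightarrow> nat set set set" where
  "PC_plus n = {\<pi> \<in> CO n. \<forall>k\<in>{1..n - 1}. \<not> same_block \<pi> k (k + 1)}"

definition PC :: "nat \<Rightarrow> nat set set set" where
  "PC n = {\<pi> \<in> PC_plus n. \<not> same_block \<pi> 1 n}"

definition adjoin :: "nat \<Rightarrow> nat set set \<Rightarrow> nat set set" where
  "adjoin n \<sigma> = (\<lambda>S. if 1 \<in> S then insert n S else S) ` \<sigma>"

text \<open>
  For \<open>n \<ge> 2\<close>, \<open>PC_plus n\<close> is the disjoint union of \<open>PC n\<close> and the injective image of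
  \<open>PC (n - 1)\<close> under \<open>adjoin n\<close>, so in the last case below \<open>\<pi>\<close> has a unique preimage.
\<close>

definition weight_b :: "(nat set set \<Rightarrow> complex) \<Rightarrow> nat \<Rightarrow> nat set set \<Rightarrow> complex" where
  "weight_b a n \<pi> =
     (if \<pi> = {{1}} then 1
      else if \<pi> \<in> PC n then a \<pi>
      else a (the_inv_into (PC (n - 1)) (adjoin n) \<pi>))"

text \<open>
  A composition \<open>(k\<^sub>1, \<dots>, k\<^sub>\<ell>)\<close> is a list; \<open>block_interval ks j\<close> is its \<open>j\<close>-th interval, with \<open>j\<close>
  counted from \<open>1\<close>.
\<close>

definition block_interval :: "nat list \<Rightarrow> nat \<Rightarrow> nat set" where
  "block_interval ks j = {sum_list (take (j - 1) ks) + 1..sum_list (take j ks)}"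

definition Phi_dom :: "nat \<Rightarrow> (nat set set \<times> nat list) set" where
  "Phi_dom n = {(\<sigma>, ks). 1 \<le> length ks \<and> length ks \<le> n \<and> \<sigma> \<in> PC_plus (length ks) \<and>
     (\<forall>k\<in>set ks. 1 \<le> k) \<and> sum_list ks = n}"

definition Phi :: "nat set set \<times> nat list \<Rightarrow> nat set set" where
  "Phi = (\<lambda>(\<sigma>, ks). (\<lambda>S. \<Union>j\<in>S. block_interval ks j) ` \<sigma>)"

text \<open>\<open>Phi\<close> maps \<open>Phi_dom n\<close> bijectively onto \<open>CO n\<close>, so \<open>the_inv_into\<close> is its inverse there.\<close>

definition weight_c :: "(nat set set \<Rightarrow> complex) \<Rightarrow> nat \<Rightarrow> nat set set \<Rightarrow> complex" where
  "weight_c a n \<pi> =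
     (case the_inv_into (Phi_dom n) Phi \<pi> of (\<sigma>, ks) \<Rightarrow> weight_b a (length ks) \<sigma>)"

definition B_fps :: "(nat set set \<Rightarrow> complex) \<Rightarrow> complex fps" where
  "B_fps a = Abs_fps (\<lambda>n. if n = 0 then 0 else \<Sum>\<pi>\<in>PC_plus n. weight_b a n \<pi>)"

definition C_fps :: "(nat set set \<Rightarrow> complex) \<Rightarrow> complex fps" where
  "C_fps a = Abs_fps (\<lambda>n. if n = 0 then 0 else \<Sum>\<pi>\<in>CO n. weight_c a n \<pi>)"

end

theory Submission imports Defs begin

text \<open>
  A composition \<open>ks\<close> of \<open>n\<close> with \<open>l\<close> parts is the same thing as a monotone surjection \<open>f\<close> from
  \<open>[n]\<close> onto \<open>[l]\<close>, whose fibres are the intervals of \<open>ks\<close>; then \<open>Phi (\<sigma>, ks)\<close> is the partition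
  of \<open>[n]\<close> into the preimages of the blocks of \<open>\<sigma>\<close>.  Pulling back along \<open>f\<close> preserves and
  reflects condition (a), and for \<open>\<sigma>\<close> satisfying (b) the map \<open>f\<close> increases from \<open>k\<close> to \<open>k + 1\<close>
  exactly if these two points lie in different blocks of the pullback.  Hence \<open>f\<close> can be recovered
  from \<open>Phi (\<sigma>, ks)\<close>, and \<open>Phi\<close> is a bijection.  This gives
  \<open>c\<^sub>n = (\<Sum>l. N(n, l) b\<^sub>l)\<close> with \<open>N(n, l)\<close> the number of compositions of \<open>n\<close> with \<open>l\<close> parts,
  which is the coefficient of \<open>x\<^sup>n\<close> in \<open>(x / (1 - x))\<^sup>l\<close>.
\<close>

section \<open>Pulling back partitions\<close>

lemma image_vimage_Int:
  assumes "S \<subseteq> f ` A"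
  shows "f ` (f -` S \<inter> A) = S"
proof (intro equalityI subsetI)
  fix y assume "y \<in> S"
  moreover from this obtain x where "x \<in> A" "y = f x" using assms by auto
  ultimately show "y \<in> f ` (f -` S \<inter> A)" by simp
qed auto

text \<open>Since \<open>f\<close> maps \<open>A\<close> onto \<open>B\<close>, taking images under
  \<open>f\<close> undoes taking preimages of subsets of \<open>B\<close>. So preimages are
  injective on \<open>\<sigma>\<close> and reflect emptiness, and as they commute with unions and
  intersections each clause of \<open>partition_on\<close> transfers both ways.\<close>

lemma partition_on_vimage_iff:
  assumes "f ` A = B" "\<sigma> \<subseteq> Pow B"
  shows "partition_on A ((\<lambda>S. f -` S \<inter> A) ` \<sigma>) \<longleftrightarrow> partition_on B \<sigma>"
proof -
  have image_vimage: "f ` (f -` S \<inter> A) = S" if "S \<subseteq> B" for S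
    using that assms(1) by (intro image_vimage_Int) simp
  have empty: "f -` S \<inter> A = {} \<longleftrightarrow> S = {}" if "S \<subseteq> B" for S
    using image_is_empty[of f "f -` S \<inter> A"] unfolding image_vimage[OF that] by (rule sym)
  have sub: "S \<subseteq> B" if "S \<in> \<sigma>" for S using that assms(2) by blast
  have inj: "inj_on (\<lambda>S. f -` S \<inter> A) \<sigma>"
    by (rule inj_on_inverseI[where g = "(`) f"]) (rule image_vimage[OF sub])
  have "\<Union>((\<lambda>S. f -` S \<inter> A) ` \<sigma>) = A \<longleftrightarrow> \<Union>\<sigma> = B"
  proof -
    have "\<Union>((\<lambda>S. f -` S \<inter> A) ` \<sigma>) = f -` \<Union>\<sigma> \<inter> A" by auto
    also have "\<dots> = A \<longleftrightarrow> B \<subseteq> \<Union>\<sigma>" unfolding assms(1)[symmetric] by blast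
    also have "\<dots> \<longleftrightarrow> \<Union>\<sigma> = B" using assms(2) by auto
    finally show ?thesis .
  qed
  moreover have "{} \<in> (\<lambda>S. f -` S \<inter> A) ` \<sigma> \<longleftrightarrow> {} \<in> \<sigma>"
  proof -
    have "(\<exists>S\<in>\<sigma>. f -` S \<inter> A = {}) \<longleftrightarrow> (\<exists>S\<in>\<sigma>. S = {})"
      by (rule bex_cong[OF refl]) (rule empty[OF sub])
    also have "\<dots> \<longleftrightarrow> {} \<in> \<sigma>" by blast
    finally show ?thesis by (simp only: image_iff eq_commute[of "{}"])
  qed
  moreover have "disjoint ((\<lambda>S. f -` S \<inter> A) ` \<sigma>) \<longleftrightarrow> disjoint \<sigma>"
  proof -
    have disj: "(f -` S \<inter> A) \<inter> (f -` T \<inter> A) = {} \<longleftrightarrow> S \<inter> T = {}" if "S \<in> \<sigma>" for S T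
    proof -
      have "(f -` S \<inter> A) \<inter> (f -` T \<inter> A) = f -` (S \<inter> T) \<inter> A" by auto
      moreover have "S \<inter> T \<subseteq> B" using sub[OF that] by auto
      ultimately show ?thesis by (simp only: empty)
    qed
    have "disjoint ((\<lambda>S. f -` S \<inter> A) ` \<sigma>) \<longleftrightarrow>
        (\<forall>S\<in>\<sigma>. \<forall>T\<in>\<sigma>. f -` S \<inter> A \<noteq> f -` T \<inter> A \<longrightarrow> (f -` S \<inter> A) \<inter> (f -` T \<inter> A) = {})"
      by (simp only: disjoint_def ball_simps)
    also have "\<dots> \<longleftrightarrow> disjoint \<sigma>"
      unfolding disjoint_def
      by (intro ball_cong refl) (simp only: disj inj_on_eq_iff[OF inj])
    finally show ?thesis .
  qed
  ultimately show ?thesis by (simp only: partition_on_def)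
qed

lemma splits_vimage:
  assumes "splits T \<sigma>"
  shows "splits (f -` T \<inter> A) ((\<lambda>S. f -` S \<inter> A) ` \<sigma>)"
proof -
  obtain \<rho> where "\<rho> \<subseteq> \<sigma>" "T = \<Union>\<rho>" using assms by (auto simp: splits_def)
  then show ?thesis
    unfolding splits_def by (intro exI[of _ "(\<lambda>S. f -` S \<inter> A) ` \<rho>"]) auto
qed

lemma splits_vimageE:
  assumes "splits J ((\<lambda>S. f -` S \<inter> A) ` \<sigma>)"
  obtains T where "splits T \<sigma>" "J = f -` T \<inter> A"
proof -
  obtain \<rho> where "\<rho> \<subseteq> (\<lambda>S. f -` S \<inter> A) ` \<sigma>" and J: "J = \<Union>\<rho>"
    using assms by (auto simp: splits_def)
  then obtain \<tau> where \<tau>: "\<tau> \<subseteq> \<sigma>" "\<rho> = (\<lambda>S. f -` S \<inter> A) ` \<tau>" by (meson subset_imageE)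
  show ?thesis
    by (rule that[of "\<Union>\<tau>"]) (use \<tau> J in \<open>auto simp: splits_def\<close>)
qed

lemma same_block_vimage:
  assumes "x \<in> A" "y \<in> A"
  shows "same_block ((\<lambda>S. f -` S \<inter> A) ` \<sigma>) x y \<longleftrightarrow> same_block \<sigma> (f x) (f y)"
  using assms by (auto simp: same_block_def)

section \<open>Connected partitions\<close>

text \<open>Intervals without named endpoints: this form passes through preimages and images of
  monotone maps directly.\<close>

definition order_convex :: "nat set \<Rightarrow> bool" where
  "order_convex T \<longleftrightarrow> (\<forall>x\<in>T. \<forall>y\<in>T. {x..y} \<subseteq> T)"

lemma order_convex_eq_interval:
  assumes "order_convex T" "finite T" "T \<noteq> {}"
  shows "T = {Min T..Max T}"
proof
  show "T \<subseteq> {Min T..Max T}" using assms(2) by auto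
  show "{Min T..Max T} \<subseteq> T"
    using assms Min_in Max_in unfolding order_convex_def by blast
qed

lemma CO_iff_order_convex:
  "\<pi> \<in> CO n \<longleftrightarrow> partition_on {1..n} \<pi> \<and>
     (\<nexists>T. T \<subseteq> {1..n} \<and> T \<noteq> {} \<and> T \<noteq> {1..n} \<and> order_convex T \<and> splits T \<pi>)"
proof -
  have "(\<exists>p q. p < p + q \<and> p + q \<le> n \<and> q < n \<and> splits {p + 1..p + q} \<pi>) \<longleftrightarrow>
      (\<exists>T. T \<subseteq> {1..n} \<and> T \<noteq> {} \<and> T \<noteq> {1..n} \<and> order_convex T \<and> splits T \<pi>)"
  proof
    assume "\<exists>p q. p < p + q \<and> p + q \<le> n \<and> q < n \<and> splits {p + 1..p + q} \<pi>"
    then obtain p q where pq: "p < p + q" "p + q \<le> n" "q < n" "splits {p + 1..p + q} \<pi>"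
      by (elim exE conjE)
    have "card {p + 1..p + q} \<noteq> card {1..n}" using pq by simp
    then have "{p + 1..p + q} \<noteq> {1..n}" by metis
    then show "\<exists>T. T \<subseteq> {1..n} \<and> T \<noteq> {} \<and> T \<noteq> {1..n} \<and> order_convex T \<and> splits T \<pi>"
      using pq by (intro exI[of _ "{p + 1..p + q}"]) (auto simp: order_convex_def)
  next
    assume "\<exists>T. T \<subseteq> {1..n} \<and> T \<noteq> {} \<and> T \<noteq> {1..n} \<and> order_convex T \<and> splits T \<pi>"
    then obtain T where T: "T \<subseteq> {1..n}" "T \<noteq> {}" "T \<noteq> {1..n}" "order_convex T" "splits T \<pi>"
      by (elim exE conjE)
    have fin: "finite T" using T(1) finite_subset by blast
    obtain u v where uv: "T = {u..v}" using order_convex_eq_interval[OF T(4) fin T(2)] by blast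
    have *: "1 \<le> u" "u \<le> v" "v \<le> n" "u \<noteq> 1 \<or> v \<noteq> n" using T(1-3) uv by auto
    \<comment> \<open>The witnesses are \<open>p = u - 1\<close> and \<open>q = v + 1 - u\<close>;
      truncated subtraction is harmless because \<open>1 \<le> u \<le> v\<close>.\<close>
    then have "{u - 1 + 1..u - 1 + (v + 1 - u)} = T" using uv by auto
    moreover have "u - 1 < u - 1 + (v + 1 - u)" "u - 1 + (v + 1 - u) \<le> n" "v + 1 - u < n"
      using * by linarith+
    ultimately show "\<exists>p q. p < p + q \<and> p + q \<le> n \<and> q < n \<and> splits {p + 1..p + q} \<pi>"
      using T(5) by metis
  qed
  moreover have "\<pi> \<in> CO n \<longleftrightarrow> partition_on {1..n} \<pi> \<and>
      \<not> (\<exists>p q. p < p + q \<and> p + q \<le> n \<and> q < n \<and> splits {p + 1..p + q} \<pi>)"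
    by (auto simp: CO_def)
  ultimately show ?thesis by (simp only:)
qed

definition monotone_onto :: "nat \<Rightarrow> nat \<Rightarrow> (nat \<Rightarrow> nat) \<Rightarrow> bool" where
  "monotone_onto n l f \<longleftrightarrow> mono_on {1..n} f \<and> f ` {1..n} = {1..l}"

text \<open>Forbidden sets correspond on the two sides: a convex \<open>T\<close> pulls back to a
  convex set, and a splitting set \<open>J\<close> of the pullback is the preimage of some
  \<open>T\<close>, which equals the image of \<open>J\<close> by surjectivity.\<close>

lemma CO_vimage_iff:
  assumes f: "monotone_onto n l f" and \<sigma>: "\<sigma> \<subseteq> Pow {1..l}"
  shows "(\<lambda>S. f -` S \<inter> {1..n}) ` \<sigma> \<in> CO n \<longleftrightarrow> \<sigma> \<in> CO l"
proof -
  let ?pre = "\<lambda>S. f -` S \<inter> {1..n}"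
  have im: "f ` {1..n} = {1..l}" and mono: "\<And>x y. x \<in> {1..n} \<Longrightarrow> y \<in> {1..n} \<Longrightarrow> x \<le> y \<Longrightarrow> f x \<le> f y"
    using f by (auto simp: monotone_onto_def mono_on_def)
  have part: "partition_on {1..n} (?pre ` \<sigma>) \<longleftrightarrow> partition_on {1..l} \<sigma>"
    by (rule partition_on_vimage_iff[OF im \<sigma>])
  have fwd: "\<exists>J. J \<subseteq> {1..n} \<and> J \<noteq> {} \<and> J \<noteq> {1..n} \<and> order_convex J \<and> splits J (?pre ` \<sigma>)"
    if T: "T \<subseteq> {1..l}" "T \<noteq> {}" "T \<noteq> {1..l}" "order_convex T" "splits T \<sigma>" for T
  proof (intro exI[of _ "?pre T"] conjI)
    have T_eq: "f ` ?pre T = T" using T(1) im by (simp add: image_vimage_Int)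
    show "?pre T \<noteq> {}" using T_eq T(2) by auto
    show "?pre T \<noteq> {1..n}" using T_eq T(3) im by auto
    show "order_convex (?pre T)" unfolding order_convex_def
    proof (intro ballI subsetI)
      fix x y z assume "x \<in> ?pre T" "y \<in> ?pre T" "z \<in> {x..y}"
      moreover from this have "z \<in> {1..n}" by auto
      moreover from calculation have "f x \<le> f z" "f z \<le> f y" by (auto intro!: mono)
      ultimately show "z \<in> ?pre T" using T(4) by (auto simp: order_convex_def subset_iff)
    qed
    show "splits (?pre T) (?pre ` \<sigma>)" by (rule splits_vimage[OF T(5)])
  qed simp
  have bwd: "\<exists>T. T \<subseteq> {1..l} \<and> T \<noteq> {} \<and> T \<noteq> {1..l} \<and> order_convex T \<and> splits T \<sigma>"
    if J: "J \<subseteq> {1..n}" "J \<noteq> {}" "J \<noteq> {1..n}" "order_convex J" "splits J (?pre ` \<sigma>)" for J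
  proof -
    obtain T where T: "splits T \<sigma>" "J = ?pre T" using splits_vimageE[OF J(5)] by blast
    have sub: "T \<subseteq> {1..l}" using T(1) \<sigma> by (auto simp: splits_def)
    then have TJ: "T = f ` J" unfolding T(2) using im by (simp add: image_vimage_Int)
    have "order_convex T" unfolding order_convex_def
    proof (intro ballI subsetI)
      fix x y z assume xyz: "x \<in> T" "y \<in> T" "z \<in> {x..y}"
      obtain u v where uv: "u \<in> J" "f u = x" "v \<in> J" "f v = y" using xyz TJ by blast
      have "z \<in> f ` {1..n}" unfolding im using xyz sub by auto
      then obtain w where w: "w \<in> {1..n}" "f w = z" by blast
      have uvn: "u \<in> {1..n}" "v \<in> {1..n}" using uv J(1) by auto
      \<comment> \<open>The point \<open>w\<close> over \<open>z\<close> may lie outside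
        \<open>{u..v}\<close>, but then monotonicity squeezes \<open>z\<close> onto an endpoint
        \<open>x\<close> or \<open>y\<close>.\<close>
      consider "w \<le> u" | "v \<le> w" | "w \<in> {u..v}" by fastforce
      then show "z \<in> T"
      proof cases
        case 1
        then have "z = x" using mono[of w u] w uv uvn xyz(3) by auto
        then show ?thesis using xyz by simp
      next
        case 2
        then have "z = y" using mono[of v w] w uv uvn xyz(3) by auto
        then show ?thesis using xyz by simp
      next
        case 3
        then have "w \<in> J" using J(4) uv unfolding order_convex_def by blast
        then show ?thesis using TJ w by blast
      qed
    qed
    moreover have "T \<noteq> {}" using TJ J(2) by simp
    moreover have "T \<noteq> {1..l}" using T(2) J(3) unfolding im[symmetric] by blast
    ultimately show ?thesis using sub T(1) by blast
  qed
  have "(\<exists>J. J \<subseteq> {1..n} \<and> J \<noteq> {} \<and> J \<noteq> {1..n} \<and> order_convex J \<and> splits J (?pre ` \<sigma>)) \<longleftrightarrow>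
      (\<exists>T. T \<subseteq> {1..l} \<and> T \<noteq> {} \<and> T \<noteq> {1..l} \<and> order_convex T \<and> splits T \<sigma>)"
    by (intro iffI; elim exE conjE) (rule bwd fwd; assumption)+
  then show ?thesis by (simp only: CO_iff_order_convex part)
qed

section \<open>Compositions and monotone surjections\<close>

lemma monotone_onto_1:
  assumes "monotone_onto n l f" "1 \<le> n"
  shows "f 1 = 1"
proof -
  have im: "f ` {1..n} = {1..l}" using assms by (simp add: monotone_onto_def)
  have "f 1 \<in> {1..l}" unfolding im[symmetric] using assms(2) by (intro imageI) simp
  then have "1 \<in> {1..l}" by auto
  then obtain c where "c \<in> {1..n}" "f c = 1" using im by (metis imageE)
  then have "f 1 \<le> 1"
    using assms mono_onD[of "{1..n}" f 1 c] by (auto simp: monotone_onto_def)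
  then show ?thesis using \<open>f 1 \<in> {1..l}\<close> by simp
qed

text \<open>Makes \<open>l\<close> readable from \<open>f\<close>, so that equal index functions
  force compositions of equal length.\<close>

lemma monotone_onto_last:
  assumes "monotone_onto n l f" "1 \<le> n"
  shows "f n = l"
proof -
  have im: "f ` {1..n} = {1..l}" using assms by (simp add: monotone_onto_def)
  have "f n \<in> {1..l}" unfolding im[symmetric] using assms(2) by (intro imageI) simp
  then have "l \<in> {1..l}" by auto
  then obtain c where "c \<in> {1..n}" "f c = l" using im by (metis imageE)
  then have "l \<le> f n" using assms by (auto simp: monotone_onto_def mono_on_def)
  then show ?thesis using \<open>f n \<in> {1..l}\<close> by simp
qed

text \<open>A larger jump would leave \<open>Suc (f k)\<close> without a preimage: points up to
  \<open>k\<close> have values at most \<open>f k\<close>, and later ones at least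
  \<open>f (Suc k)\<close>.\<close>

lemma monotone_onto_Suc:
  assumes "monotone_onto n l f" "1 \<le> k" "k < n"
  shows "f (Suc k) = f k \<or> f (Suc k) = Suc (f k)"
proof -
  have im: "f ` {1..n} = {1..l}" and mono: "\<And>x y. x \<in> {1..n} \<Longrightarrow> y \<in> {1..n} \<Longrightarrow> x \<le> y \<Longrightarrow> f x \<le> f y"
    using assms by (auto simp: monotone_onto_def mono_on_def)
  have le: "f k \<le> f (Suc k)" using assms by (intro mono) auto
  have "\<not> Suc (f k) < f (Suc k)"
  proof
    assume gt: "Suc (f k) < f (Suc k)"
    have "f (Suc k) \<in> {1..l}" unfolding im[symmetric] using assms by (intro imageI) simp
    then have "Suc (f k) \<in> {1..l}" using gt by auto
    then obtain c where c: "c \<in> {1..n}" "f c = Suc (f k)" using im by (metis imageE)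
    show False
    proof (cases "c \<le> k")
      case True
      then have "f c \<le> f k" using c assms by (intro mono) auto
      then show False using c by simp
    next
      case False
      then have "f (Suc k) \<le> f c" using c assms by (intro mono) auto
      then show False using c gt by simp
    qed
  qed
  then show ?thesis using le by linarith
qed

section \<open>Partial sums of a composition and its index function\<close>

lemma sum_list_take_mono:
  fixes ks :: "nat list"
  assumes "i \<le> j"
  shows "sum_list (take i ks) \<le> sum_list (take j ks)"
proof -
  have "take j ks = take i ks @ take (j - i) (drop i ks)"
    using assms by (metis le_add_diff_inverse take_add)
  then show ?thesis by simp
qed

lemma sum_list_take_Suc:
  fixes ks :: "nat list"
  assumes "j < length ks"
  shows "sum_list (take (Suc j) ks) = sum_list (take j ks) + ks ! j"
  using assms by (simp add: take_Suc_conv_app_nth)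

text \<open>For \<open>x\<close> in \<open>{1..sum_list ks}\<close> this is the number of the
  interval containing \<open>x\<close>, counted from 1. It is the monotone surjection attached to
  \<open>ks\<close>.\<close>

definition index_of :: "nat list \<Rightarrow> nat \<Rightarrow> nat" where
  "index_of ks x = (LEAST j. x \<le> sum_list (take j ks))"

text \<open>A Galois connection between the index function and the partial sums. The bound on
  \<open>x\<close> guarantees that the \<open>LEAST\<close> is attained.\<close>

lemma index_of_le_iff:
  assumes "x \<le> sum_list ks"
  shows "index_of ks x \<le> j \<longleftrightarrow> x \<le> sum_list (take j ks)"
proof
  have "x \<le> sum_list (take (index_of ks x) ks)"
    unfolding index_of_def by (rule LeastI[of _ "length ks"]) (use assms in simp)
  also assume "index_of ks x \<le> j"
  then have "sum_list (take (index_of ks x) ks) \<le> sum_list (take j ks)"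
    by (rule sum_list_take_mono)
  finally show "x \<le> sum_list (take j ks)" .
qed (simp add: index_of_def Least_le)

lemma block_interval_eq_fibre:
  assumes "1 \<le> j" "sum_list ks = n"
  shows "block_interval ks j = index_of ks -` {j} \<inter> {1..n}"
proof -
  have "x \<in> block_interval ks j \<longleftrightarrow> index_of ks x = j \<and> x \<in> {1..n}" for x
  proof (cases "x \<le> n")
    case True
    have "x \<in> block_interval ks j \<longleftrightarrow> \<not> index_of ks x \<le> j - 1 \<and> index_of ks x \<le> j"
      using True assms by (auto simp: block_interval_def index_of_le_iff)
    also have "\<dots> \<longleftrightarrow> index_of ks x = j" using assms by auto
    finally have *: "x \<in> block_interval ks j \<longleftrightarrow> index_of ks x = j" .
    moreover have "x \<in> block_interval ks j \<Longrightarrow> 1 \<le> x" by (auto simp: block_interval_def)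
    ultimately show ?thesis using True by auto
  next
    case False
    moreover have "sum_list (take j ks) \<le> n"
      \<comment> \<open>Taking \<open>max j (length ks)\<close> entries yields the whole list, which
        also covers \<open>j\<close> beyond the length.\<close>
      using sum_list_take_mono[of j "max j (length ks)" ks] assms by simp
    ultimately show ?thesis by (auto simp: block_interval_def)
  qed
  then show ?thesis by (simp only: set_eq_iff Int_iff vimage_singleton_eq simp_thms)
qed

lemma card_block_interval:
  assumes "j < length ks"
  shows "card (block_interval ks (Suc j)) = ks ! j"
  using assms by (simp add: block_interval_def sum_list_take_Suc)

text \<open>Monotonicity comes from the Galois connection; surjectivity holds because the fibre over
  \<open>Suc i\<close> has \<open>ks ! i \<ge> 1\<close> elements.\<close>

lemma monotone_onto_index_of:
  assumes "\<forall>k\<in>set ks. 1 \<le> k" "sum_list ks = n"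
  shows "monotone_onto n (length ks) (index_of ks)"
  unfolding monotone_onto_def
proof
  show "mono_on {1..n} (index_of ks)"
  proof (rule mono_onI)
    fix x y assume "x \<in> {1..n}" "y \<in> {1..n}" "x \<le> y"
    moreover from this have "y \<le> sum_list (take (index_of ks y) ks)"
      using assms index_of_le_iff[of y ks] by auto
    ultimately show "index_of ks x \<le> index_of ks y"
      using assms by (simp add: index_of_le_iff)
  qed
  show "index_of ks ` {1..n} = {1..length ks}"
  proof (intro equalityI subsetI)
    fix j assume "j \<in> index_of ks ` {1..n}"
    then obtain x where x: "1 \<le> x" "x \<le> n" "j = index_of ks x" by auto
    then have "\<not> index_of ks x \<le> 0" "index_of ks x \<le> length ks"
      using assms by (auto simp: index_of_le_iff simp del: le_zero_eq)
    then show "j \<in> {1..length ks}" using x by auto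
  next
    fix j assume j: "j \<in> {1..length ks}"
    then obtain i where i: "j = Suc i" "i < length ks" by (cases j) auto
    then have "1 \<le> card (block_interval ks j)" using assms by (simp add: card_block_interval)
    then have "block_interval ks j \<noteq> {}" by auto
    then show "j \<in> index_of ks ` {1..n}" using block_interval_eq_fibre[of j ks n] j assms by auto
  qed
qed

text \<open>The length is the value at \<open>n\<close>, and each part is the cardinality of a
  fibre.\<close>

lemma index_of_inject:
  assumes "\<forall>k\<in>set ks. 1 \<le> k" "sum_list ks = n" "\<forall>k\<in>set ks'. 1 \<le> k" "sum_list ks' = n"
    and "1 \<le> n" and eq: "\<And>x. x \<in> {1..n} \<Longrightarrow> index_of ks x = index_of ks' x"
  shows "ks = ks'"
proof (rule nth_equalityI)
  show len: "length ks = length ks'"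
    using monotone_onto_last[OF monotone_onto_index_of, of ks n]
      monotone_onto_last[OF monotone_onto_index_of, of ks' n] eq[of n] assms by simp
  fix i assume i: "i < length ks"
  have "block_interval ks (Suc i) = block_interval ks' (Suc i)"
    using eq assms by (auto simp: block_interval_eq_fibre)
  then show "ks ! i = ks' ! i" using i len by (metis card_block_interval)
qed

text \<open>The parts are the fibre sizes of \<open>f\<close>. Their partial sums count the points
  with \<open>f x \<le> j\<close>, and the Galois connection then identifies
  \<open>index_of ks\<close> with \<open>f\<close>.\<close>

lemma composition_of_monotone_onto:
  assumes f: "monotone_onto n l f"
  obtains ks where "length ks = l" "\<forall>k\<in>set ks. 1 \<le> k" "sum_list ks = n"
    "\<And>x. x \<in> {1..n} \<Longrightarrow> index_of ks x = f x"
proof -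
  have im: "f ` {1..n} = {1..l}" and mono: "\<And>x y. x \<in> {1..n} \<Longrightarrow> y \<in> {1..n} \<Longrightarrow> x \<le> y \<Longrightarrow> f x \<le> f y"
    using f by (auto simp: monotone_onto_def mono_on_def)
  \<comment> \<open>List positions start at 0 and values of \<open>f\<close> at 1, hence the
    shift.\<close>
  define fib where "fib j = {x \<in> {1..n}. f x = Suc j}" for j
  define ks where "ks = map (\<lambda>j. card (fib j)) [0..<l]"
  have len: "length ks = l" by (simp add: ks_def)
  have pos: "\<forall>k\<in>set ks. 1 \<le> k"
  proof
    fix k assume "k \<in> set ks"
    then obtain j where j: "j < l" "k = card (fib j)" by (auto simp: ks_def)
    then have "Suc j \<in> f ` {1..n}" using im by auto
    then have "fib j \<noteq> {}" by (auto simp: fib_def)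
    then show "1 \<le> k" using j by (simp add: fib_def Suc_leI card_gt_0_iff)
  qed
  have part: "sum_list (take j ks) = card {x \<in> {1..n}. f x \<le> j}" if "j \<le> l" for j
    using that
  proof (induction j)
    case 0
    have "{x \<in> {1..n}. f x \<le> 0} = {}" using im by force
    then show ?case by simp
  next
    case (Suc j)
    have "{x \<in> {1..n}. f x \<le> Suc j} = {x \<in> {1..n}. f x \<le> j} \<union> fib j"
      by (auto simp: fib_def)
    moreover have "card ({x \<in> {1..n}. f x \<le> j} \<union> fib j) = card {x \<in> {1..n}. f x \<le> j} + card (fib j)"
      by (rule card_Un_disjoint) (auto simp: fib_def)
    moreover have "ks ! j = card (fib j)" using Suc by (simp add: ks_def)
    ultimately show ?case using Suc len by (simp add: sum_list_take_Suc)
  qed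
  have "{x \<in> {1..n}. f x \<le> l} = {1..n}" using im by auto
  then have sum: "sum_list ks = n" using part[of l] len by simp
  have "index_of ks x = f x" if x: "x \<in> {1..n}" for x
  proof -
    \<comment> \<open>By monotonicity the counted set is an initial segment of
      \<open>{1..n}\<close>, so comparing \<open>x\<close> with its size tests membership.\<close>
    have iff: "x \<le> card {y \<in> {1..n}. f y \<le> j} \<longleftrightarrow> f x \<le> j" for j
    proof
      assume "f x \<le> j"
      then have "f y \<le> j" if "y \<in> {1..x}" for y using x that mono[of y x] by auto
      then have "{1..x} \<subseteq> {y \<in> {1..n}. f y \<le> j}" using x by auto
      then have "card {1..x} \<le> card {y \<in> {1..n}. f y \<le> j}" by (intro card_mono) auto
      then show "x \<le> card {y \<in> {1..n}. f y \<le> j}" by simp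
    next
      assume le: "x \<le> card {y \<in> {1..n}. f y \<le> j}"
      show "f x \<le> j"
      proof (rule ccontr)
        assume "\<not> f x \<le> j"
        then have "y < x" if "y \<in> {1..n}" "f y \<le> j" for y
          using mono[OF x that(1)] that(2) by (rule_tac ccontr) simp
        then have "{y \<in> {1..n}. f y \<le> j} \<subseteq> {1..x - 1}" by fastforce
        then have "card {y \<in> {1..n}. f y \<le> j} \<le> card {1..x - 1}" by (intro card_mono) auto
        then have "x \<le> x - 1" using le by simp
        then show False using x by auto
      qed
    qed
    have xs: "x \<le> sum_list ks" using x sum by simp
    have fl: "f x \<in> {1..l}" using im x by blast
    have "index_of ks x \<le> f x" using fl iff[of "f x"] part[of "f x"] index_of_le_iff[OF xs] by simp
    moreover have "\<not> index_of ks x \<le> f x - 1"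
      using fl iff[of "f x - 1"] part[of "f x - 1"] index_of_le_iff[OF xs] by auto
    ultimately show ?thesis by linarith
  qed
  then show ?thesis using that len pos sum by blast
qed

section \<open>The bijection\<close>

lemma PC_plus_subset_Pow: "\<sigma> \<in> PC_plus l \<Longrightarrow> \<sigma> \<subseteq> Pow {1..l}"
  unfolding PC_plus_def CO_def partition_on_def by blast

lemma Phi_eq_vimage:
  assumes "sum_list ks = n" "\<sigma> \<subseteq> Pow {1..length ks}"
  shows "Phi (\<sigma>, ks) = (\<lambda>S. index_of ks -` S \<inter> {1..n}) ` \<sigma>"
proof -
  have "(\<Union>j\<in>S. block_interval ks j) = index_of ks -` S \<inter> {1..n}" if "S \<in> \<sigma>" for S
  proof -
    have "1 \<le> j" if "j \<in> S" for j using that \<open>S \<in> \<sigma>\<close> assms(2) by fastforce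
    then have "(\<Union>j\<in>S. block_interval ks j) = (\<Union>j\<in>S. index_of ks -` {j} \<inter> {1..n})"
      using assms(1) by (intro SUP_cong block_interval_eq_fibre refl)
    then show ?thesis by auto
  qed
  then show ?thesis by (simp add: Phi_def)
qed

text \<open>If \<open>f\<close> stays constant, both points lie over one element, which some block
  covers; if \<open>f\<close> increases, condition (b) for \<open>\<sigma>\<close> separates them.
  Thus the pullback alone reveals where \<open>f\<close> increases.\<close>

lemma PC_plus_pullback_step_iff:
  assumes f: "monotone_onto n l f" and \<sigma>: "\<sigma> \<in> PC_plus l" and k: "1 \<le> k" "k < n"
  shows "same_block ((\<lambda>S. f -` S \<inter> {1..n}) ` \<sigma>) k (Suc k) \<longleftrightarrow> f (Suc k) = f k"
proof -
  have im: "f ` {1..n} = {1..l}" using f by (simp add: monotone_onto_def)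
  have k1: "k \<in> {1..n}" and k2: "Suc k \<in> {1..n}" using k by auto
  have fk: "f k \<in> {1..l}" "f (Suc k) \<in> {1..l}" using im k1 k2 by blast+
  have "\<Union>\<sigma> = {1..l}" using \<sigma> by (auto simp: PC_plus_def CO_def partition_on_def)
  then have "same_block \<sigma> (f k) (f k)" using fk(1) unfolding same_block_def by blast
  moreover have "\<not> same_block \<sigma> (f k) (Suc (f k))" if "f (Suc k) = Suc (f k)"
    using \<sigma> fk that by (auto simp: PC_plus_def)
  ultimately show ?thesis
    unfolding same_block_vimage[OF k1 k2] using monotone_onto_Suc[OF f k] by force
qed

lemma Phi_in_CO:
  assumes "x \<in> Phi_dom n"
  shows "Phi x \<in> CO n"
proof -
  obtain \<sigma> ks where x: "x = (\<sigma>, ks)" by (cases x)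
  then have *: "\<sigma> \<in> PC_plus (length ks)" "\<forall>k\<in>set ks. 1 \<le> k" "sum_list ks = n"
    using assms by (auto simp: Phi_dom_def)
  have sub: "\<sigma> \<subseteq> Pow {1..length ks}" using *(1) by (rule PC_plus_subset_Pow)
  have "\<sigma> \<in> CO (length ks)" using *(1) by (simp add: PC_plus_def)
  then show ?thesis
    unfolding x Phi_eq_vimage[OF *(3) sub]
    using CO_vimage_iff[OF monotone_onto_index_of[OF *(2,3)] sub] by simp
qed

text \<open>Both index functions start at 1 and increase at the same places, which are read off from
  the common image. Once the compositions agree, \<open>\<sigma>\<close> is recovered by taking
  images of blocks.\<close>

lemma inj_on_Phi:
  assumes "1 \<le> n"
  shows "inj_on Phi (Phi_dom n)"
proof (rule inj_onI, clarify)
  fix \<sigma> \<sigma>' :: "nat set set" and ks ks' :: "nat list"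
  assume "(\<sigma>, ks) \<in> Phi_dom n" "(\<sigma>', ks') \<in> Phi_dom n" and eq: "Phi (\<sigma>, ks) = Phi (\<sigma>', ks')"
  then have dom: "\<sigma> \<in> PC_plus (length ks)" "\<forall>k\<in>set ks. 1 \<le> k" "sum_list ks = n"
    and dom': "\<sigma>' \<in> PC_plus (length ks')" "\<forall>k\<in>set ks'. 1 \<le> k" "sum_list ks' = n"
    by (auto simp: Phi_dom_def)
  note sub = PC_plus_subset_Pow[OF dom(1)] and sub' = PC_plus_subset_Pow[OF dom'(1)]
  note mono = monotone_onto_index_of[OF dom(2,3)] and mono' = monotone_onto_index_of[OF dom'(2,3)]
  let ?pre = "\<lambda>S. index_of ks -` S \<inter> {1..n}"
  let ?pre' = "\<lambda>S. index_of ks' -` S \<inter> {1..n}"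
  have eq: "?pre ` \<sigma> = ?pre' ` \<sigma>'"
    using eq by (simp add: Phi_eq_vimage[OF dom(3) sub] Phi_eq_vimage[OF dom'(3) sub'])
  have "index_of ks x = index_of ks' x" if "1 \<le> x" "x \<le> n" for x
    using that
  proof (induction x rule: nat_induct_at_least)
    case base
    show ?case using monotone_onto_1[OF mono assms] monotone_onto_1[OF mono' assms] by simp
  next
    case (Suc x)
    have "index_of ks (Suc x) = index_of ks x \<longleftrightarrow> index_of ks' (Suc x) = index_of ks' x"
      using Suc PC_plus_pullback_step_iff[OF mono dom(1), of x]
        PC_plus_pullback_step_iff[OF mono' dom'(1), of x] eq by simp
    then show ?case
      using Suc monotone_onto_Suc[OF mono, of x] monotone_onto_Suc[OF mono', of x] by auto
  qed
  then have ks: "ks = ks'"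
    using index_of_inject[of ks n ks'] dom dom' assms by simp
  have "index_of ks ` ?pre S = S" if "S \<subseteq> {1..length ks}" for S
    using that mono by (simp add: monotone_onto_def image_vimage_Int)
  then have "(\<lambda>S. index_of ks ` ?pre S) ` \<tau> = (\<lambda>S. S) ` \<tau>" if "\<tau> \<subseteq> Pow {1..length ks}" for \<tau>
    using that by (intro image_cong refl) auto
  then have recover: "(`) (index_of ks) ` ?pre ` \<tau> = \<tau>" if "\<tau> \<subseteq> Pow {1..length ks}" for \<tau>
    using that by (simp add: image_image)
  have "\<sigma> = (`) (index_of ks) ` ?pre ` \<sigma>" by (rule recover[OF sub, symmetric])
  also have "\<dots> = \<sigma>'"
    \<comment> \<open>\<open>eq\<close> introduces preimages under \<open>index_of ks'\<close>;
      replacing \<open>ks'\<close> by \<open>ks\<close> brings them into the form of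
      \<open>recover\<close>.\<close>
    unfolding eq unfolding ks[symmetric] by (rule recover) (use sub' ks in simp)
  finally have "\<sigma> = \<sigma>'" .
  then show "\<sigma> = \<sigma>' \<and> ks = ks'" using ks by simp
qed

text \<open>Collapsing each maximal run of consecutive points in a common block gives a partition
  with (b). It keeps (a), because \<open>CO_vimage_iff\<close> also reflects connectedness.\<close>

lemma CO_subset_image_Phi:
  assumes n: "1 \<le> n" and \<pi>: "\<pi> \<in> CO n"
  shows "\<pi> \<in> Phi ` Phi_dom n"
proof -
  have part: "\<Union>\<pi> = {1..n}" "disjoint \<pi>" using \<pi> by (auto simp: CO_def partition_on_def)
  have tr: "same_block \<pi> x z" if xy: "same_block \<pi> x y" and yz: "same_block \<pi> y z" for x y z
  proof -
    obtain S T where "S \<in> \<pi>" "x \<in> S" "y \<in> S" "T \<in> \<pi>" "y \<in> T" "z \<in> T"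
      using xy yz unfolding same_block_def by blast
    moreover from this have "S = T" using disjointD[OF part(2), of S T] by blast
    ultimately show ?thesis unfolding same_block_def by blast
  qed
  \<comment> \<open>\<open>f\<close> numbers the maximal runs from 1, by counting the places before
    \<open>k\<close> where neighbours are separated.\<close>
  define f where "f k = Suc (card {i \<in> {1..<k}. \<not> same_block \<pi> i (Suc i)})" for k
  have f_Suc: "f (Suc k) = (if same_block \<pi> k (Suc k) then f k else Suc (f k))" if "1 \<le> k" for k
  proof -
    have "{i \<in> {1..<Suc k}. \<not> same_block \<pi> i (Suc i)} =
      {i \<in> {1..<k}. \<not> same_block \<pi> i (Suc i)} \<union> (if same_block \<pi> k (Suc k) then {} else {k})"
      using that by (auto simp: less_Suc_eq)
    then show ?thesis by (auto simp: f_def)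
  qed
  have f_pos: "1 \<le> f k" for k by (simp add: f_def)
  have f_mono: "f x \<le> f y" if "x \<le> y" for x y
    unfolding f_def using that by (intro Suc_le_mono[THEN iffD2] card_mono) auto
  have im: "f ` {1..m} = {1..f m}" if "1 \<le> m" for m
    using that
  proof (induction m rule: nat_induct_at_least)
    case base
    then show ?case by (simp add: f_def)
  next
    case (Suc m)
    have "f ` {1..Suc m} = insert (f (Suc m)) (f ` {1..m})" using Suc by (simp add: atLeastAtMostSuc_conv)
    also have "\<dots> = insert (f (Suc m)) {1..f m}" by (simp only: Suc.IH)
    also have "\<dots> = {1..f (Suc m)}"
      using Suc.hyps f_Suc[of m] f_pos[of m] by auto
    finally show ?case .
  qed
  have f: "monotone_onto n (f n) f"
    using im[OF n] f_mono by (auto simp: monotone_onto_def mono_on_def)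
  have conn: "same_block \<pi> x y" if "x \<in> {1..n}" "y \<in> {1..n}" "x \<le> y" "f x = f y" for x y
    using that(3,2,4)
  proof (induction y rule: dec_induct)
    case base
    then show ?case using that(1) part by (auto simp: same_block_def)
  next
    case (step y)
    have "f x \<le> f y" by (rule f_mono[OF step.hyps(1)])
    moreover have "f y \<le> f (Suc y)" by (rule f_mono) simp
    ultimately have "f x = f y" "f (Suc y) = f y" using step.prems(2) by linarith+
    then have "same_block \<pi> x y" "same_block \<pi> y (Suc y)"
      using step that(1) f_Suc[of y] by (auto split: if_splits)
    then show ?case by (rule tr)
  qed
  \<comment> \<open>By \<open>conn\<close> each fibre lies inside one block, so every block is a
    union of fibres.\<close>
  have pre_image: "f -` (f ` S) \<inter> {1..n} = S" if S: "S \<in> \<pi>" for S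
  proof (intro equalityI subsetI)
    fix x assume "x \<in> f -` (f ` S) \<inter> {1..n}"
    then obtain y where y: "y \<in> S" "f x = f y" and x: "x \<in> {1..n}" by auto
    then have "y \<in> {1..n}" using S part by auto
    then have "same_block \<pi> x y \<or> same_block \<pi> y x" using conn x y by (metis nle_le)
    then obtain T where "T \<in> \<pi>" "x \<in> T" "y \<in> T" by (auto simp: same_block_def)
    then show "x \<in> S" using S y disjointD[OF part(2), of S T] by blast
  qed (use S part in auto)
  define \<sigma> where "\<sigma> = (`) f ` \<pi>"
  have pre: "(\<lambda>S. f -` S \<inter> {1..n}) ` \<sigma> = \<pi>"
    using pre_image by (simp add: \<sigma>_def image_image)
  have sub: "\<sigma> \<subseteq> Pow {1..f n}"
    using im[OF n] part(1) by (auto simp: \<sigma>_def)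
  have "\<sigma> \<in> CO (f n)" using CO_vimage_iff[OF f sub] pre \<pi> by simp
  moreover have "\<not> same_block \<sigma> j (j + 1)" if j: "j \<in> {1..f n - 1}" for j
  proof
    assume sb: "same_block \<sigma> j (j + 1)"
    \<comment> \<open>The last point not above level \<open>j\<close>. There \<open>f\<close> steps
      from \<open>j\<close> to \<open>j + 1\<close>, which by \<open>f_Suc\<close> happens only
      between different blocks of \<open>\<pi>\<close>, against \<open>sb\<close>.\<close>
    define k where "k = Max {k \<in> {1..n}. f k \<le> j}"
    have "f 1 = 1" using f n by (rule monotone_onto_1)
    then have "1 \<in> {k \<in> {1..n}. f k \<le> j}" using j n by auto
    then have kin: "k \<in> {k \<in> {1..n}. f k \<le> j}" unfolding k_def by (intro Max_in) auto
    then have k: "1 \<le> k" "k < n" using j by (auto simp: order.order_iff_strict)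
    have "\<not> f (Suc k) \<le> j"
    proof
      assume "f (Suc k) \<le> j"
      then have "Suc k \<in> {k \<in> {1..n}. f k \<le> j}" using k by auto
      then have "Suc k \<le> k" unfolding k_def by (intro Max_ge) auto
      then show False by simp
    qed
    then have "f k = j" "f (Suc k) = j + 1" "\<not> same_block \<pi> k (Suc k)"
      using f_Suc[OF k(1)] kin by (auto split: if_splits)
    moreover have "same_block \<pi> k (Suc k) \<longleftrightarrow> same_block \<sigma> (f k) (f (Suc k))"
      using same_block_vimage[of k "{1..n}" "Suc k" f \<sigma>] k unfolding pre by simp
    ultimately show False using sb by simp
  qed
  ultimately have PCp: "\<sigma> \<in> PC_plus (f n)" by (auto simp: PC_plus_def)
  obtain ks where ks: "length ks = f n" "\<forall>k\<in>set ks. 1 \<le> k" "sum_list ks = n"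
    "\<And>x. x \<in> {1..n} \<Longrightarrow> index_of ks x = f x"
    using composition_of_monotone_onto[OF f] by blast
  have "f n \<le> n"
    using im[OF n] card_image_le[of "{1..n}" f] by simp
  then have "(\<sigma>, ks) \<in> Phi_dom n" using ks PCp by (auto simp: Phi_dom_def f_def)
  moreover have "Phi (\<sigma>, ks) = \<pi>"
  proof -
    have "index_of ks -` S \<inter> {1..n} = f -` S \<inter> {1..n}" for S using ks(4) by auto
    then show ?thesis using Phi_eq_vimage[OF ks(3), of \<sigma>] sub ks(1) pre by simp
  qed
  ultimately show ?thesis by (metis imageI)
qed

lemma bij_betw_Phi:
  assumes "1 \<le> n"
  shows "bij_betw Phi (Phi_dom n) (CO n)"
  unfolding bij_betw_def
  using inj_on_Phi[OF assms] Phi_in_CO CO_subset_image_Phi[OF assms] by blast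

section \<open>Counting compositions\<close>

unbundle fps_syntax

definition compositions :: "nat \<Rightarrow> nat \<Rightarrow> nat list set" where
  "compositions n l = {ks. length ks = l \<and> (\<forall>k\<in>set ks. 1 \<le> k) \<and> sum_list ks = n}"

text \<open>\<open>natpermute n l\<close> allows zero entries; it indexes the coefficient formula
  for powers of a series.\<close>

lemma compositions_subset_natpermute: "compositions n l \<subseteq> natpermute n l"
  by (auto simp: compositions_def natpermute_def)

lemma finite_compositions: "finite (compositions n l)"
  by (rule finite_subset[OF compositions_subset_natpermute natpermute_finite])

lemma fps_nth_X_div_one_minus_X:
  "(fps_X / (1 - fps_X) :: 'a::field fps) $ n = (if n = 0 then 0 else 1)"
proof -
  have "(fps_X / (1 - fps_X) :: 'a fps) = fps_X * Abs_fps (\<lambda>_. 1)"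
    by (subst fps_divide_unit) (simp_all only: fps_inverse_one_minus_fps_X, simp)
  then show ?thesis by simp
qed

text \<open>In the expansion over \<open>natpermute n l\<close> a list contributes 1 if all its
  entries are positive and 0 otherwise.\<close>

lemma fps_nth_X_div_one_minus_X_power:
  assumes "l \<noteq> 0"
  shows "((fps_X / (1 - fps_X)) ^ l :: 'a::field fps) $ n = of_nat (card (compositions n l))"
proof -
  obtain m where m: "l = Suc m" using assms by (cases l) auto
  have "((fps_X / (1 - fps_X)) ^ l :: 'a fps) $ n =
      (\<Sum>v\<in>natpermute n l. \<Prod>j\<in>{0..m}. (fps_X / (1 - fps_X) :: 'a fps) $ (v ! j))"
    unfolding m by (subst fps_power_nth_Suc) (simp only: Suc_eq_plus1)
  also have "\<dots> = (\<Sum>v\<in>natpermute n l. if v \<in> compositions n l then 1 else 0)"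
  proof (rule sum.cong[OF refl])
    fix v assume v: "v \<in> natpermute n l"
    then have len: "length v = Suc m" by (simp add: natpermute_def m)
    have "v \<in> compositions n l \<longleftrightarrow> (\<forall>j\<in>{0..m}. v ! j \<noteq> 0)"
      using v len by (force simp: compositions_def natpermute_def in_set_conv_nth Suc_le_eq less_Suc_eq_le)
    then show "(\<Prod>j\<in>{0..m}. (fps_X / (1 - fps_X) :: 'a fps) $ (v ! j)) =
        (if v \<in> compositions n l then 1 else 0)"
      by (auto simp: fps_nth_X_div_one_minus_X intro: prod.neutral)
  qed
  also have "\<dots> = (\<Sum>v\<in>compositions n l. 1)"
    by (rule sum.mono_neutral_cong_right)
      (simp_all add: natpermute_finite compositions_subset_natpermute)
  also have "\<dots> = of_nat (card (compositions n l))" by simp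
  finally show ?thesis .
qed

section \<open>Regrouping the weight sum by the number of parts\<close>

lemma Phi_dom_eq_Union:
  "Phi_dom n = (\<Union>l\<in>{1..n}. PC_plus l \<times> compositions n l)"
  by (auto simp: Phi_dom_def compositions_def)

lemma finite_PC_plus: "finite (PC_plus l)"
proof (rule finite_subset)
  show "PC_plus l \<subseteq> Pow (Pow {1..l})" using PC_plus_subset_Pow by blast
qed simp

text \<open>Reindexing along \<open>Phi\<close> cancels the inverse in \<open>weight_c\<close>. The
  remaining summand depends on \<open>ks\<close> only through its length, so each \<open>l\<close>
  contributes a factor counting compositions.\<close>

lemma sum_weight_c:
  assumes "1 \<le> n"
  shows "(\<Sum>\<pi>\<in>CO n. weight_c a n \<pi>) =
    (\<Sum>l=1..n. of_nat (card (compositions n l)) * (\<Sum>\<sigma>\<in>PC_plus l. weight_b a l \<sigma>))"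
proof -
  note inj = inj_on_Phi[OF assms]
  have "(\<Sum>\<pi>\<in>CO n. weight_c a n \<pi>) = (\<Sum>x\<in>Phi_dom n. weight_c a n (Phi x))"
    by (rule sum.reindex_bij_betw[OF bij_betw_Phi[OF assms], symmetric])
  also have "\<dots> = (\<Sum>x\<in>Phi_dom n. case x of (\<sigma>, ks) \<Rightarrow> weight_b a (length ks) \<sigma>)"
    by (intro sum.cong refl) (simp add: weight_c_def the_inv_into_f_f[OF inj])
  also have "\<dots> = (\<Sum>l=1..n. \<Sum>x\<in>PC_plus l \<times> compositions n l.
      case x of (\<sigma>, ks) \<Rightarrow> weight_b a (length ks) \<sigma>)"
    unfolding Phi_dom_eq_Union
    \<comment> \<open>The pieces are disjoint because the length of \<open>ks\<close> determines
      \<open>l\<close>.\<close>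
    by (rule sum.UNION_disjoint)
      (simp_all add: finite_PC_plus finite_compositions, auto simp: compositions_def)
  also have "\<dots> = (\<Sum>l=1..n. of_nat (card (compositions n l)) * (\<Sum>\<sigma>\<in>PC_plus l. weight_b a l \<sigma>))"
  proof (rule sum.cong[OF refl])
    fix l
    have "(\<Sum>x\<in>PC_plus l \<times> compositions n l. case x of (\<sigma>, ks) \<Rightarrow> weight_b a (length ks) \<sigma>) =
        (\<Sum>\<sigma>\<in>PC_plus l. \<Sum>ks\<in>compositions n l. weight_b a l \<sigma>)"
      unfolding sum.cartesian_product by (rule sum.cong) (auto simp: compositions_def)
    then show "(\<Sum>x\<in>PC_plus l \<times> compositions n l. case x of (\<sigma>, ks) \<Rightarrow> weight_b a (length ks) \<sigma>) =
        of_nat (card (compositions n l)) * (\<Sum>\<sigma>\<in>PC_plus l. weight_b a l \<sigma>)"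
      by (simp add: sum_distrib_left)
  qed
  finally show ?thesis .
qed

theorem lemma2p8:
  fixes a :: "nat set set \<Rightarrow> complex"
  shows "C_fps a = B_fps a oo (fps_X / (1 - fps_X))"
proof (rule fps_ext)
  fix n
  show "C_fps a $ n = (B_fps a oo (fps_X / (1 - fps_X))) $ n"
  proof (cases "n = 0")
    case True
    then show ?thesis by (simp add: C_fps_def B_fps_def)
  next
    case False
    \<comment> \<open>Stopping at \<open>l = n\<close> loses nothing: x/(1-x) has zero constant
      term, so its higher powers do not reach degree \<open>n\<close>.\<close>
    have "(B_fps a oo (fps_X / (1 - fps_X))) $ n =
        (\<Sum>l=0..n. B_fps a $ l * ((fps_X / (1 - fps_X)) ^ l $ n))"
      by (simp add: fps_compose_nth)
    \<comment> \<open>The summand at \<open>l = 0\<close> vanishes because \<open>B_fps a\<close>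
      has constant coefficient 0.\<close>
    also have "\<dots> = (\<Sum>l=1..n. B_fps a $ l * ((fps_X / (1 - fps_X)) ^ l $ n))"
      by (rule sum.mono_neutral_right) (auto simp: B_fps_def)
    also have "\<dots> = (\<Sum>l=1..n. of_nat (card (compositions n l)) * (\<Sum>\<sigma>\<in>PC_plus l. weight_b a l \<sigma>))"
      by (rule sum.cong) (auto simp: B_fps_def fps_nth_X_div_one_minus_X_power)
    also have "\<dots> = C_fps a $ n"
      using sum_weight_c[of n a] False by (simp add: C_fps_def)
    finally show ?thesis ..
  qed
qed

end
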